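(* For finite abstract simplicial complexes $G$ and $H$, the connection spectra satisfy $\sigma(G\times H)=\sigma(G)\,\sigma(H)$, i.e. the eigenvalues of $L(G\times H)$ are the products $\lambda\mu$ of an eigenvalue $\lambda$ of $L(G)$ and an eigenvalue $\mu$ of $L(H)$ (counted with multiplicity).
   Context: A finite abstract simplicial complex is a finite set of non-empty finite sets which is closed under taking non-empty subsets. The Cartesian product $G\times H$ of two such complexes is the set of all set-theoretic Cartesian products $x\times y$ with $x\in G$, $y\in H$ (in general it is not a simplicial complex). For $K$ a simplicial complex or a product of simplicial complexes, the connection graph $K'$ has the elements (cells) of $K$ as vertices, and two different cells are joined by an edge if they intersect as sets. The connection Laplacian is $L(K)=1+A$, where $A$ is the adjacency matrix of $K'$. The connection spectrum $\sigma(K)$ is the spectrum of $L(K)$, and $\sigma(G)\sigma(H)$ denotes the set of products of an element of $\sigma(G)$ with an element of $\sigma(H)$. *)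

theory Defs
  imports
    "Graph_Theory.Pair_Digraph"
    "Jordan_Normal_Form.Spectral_Radius"
    "HOL-Computational_Algebra.Fundamental_Theorem_Algebra"
begin

text \<open>No Euclidean realisation and no fixed vertex set: only the family of faces is given.
  The empty family is allowed.\<close>

definition finite_abstract_simplicial_complex :: "'a set set \<Rightarrow> bool" where
  "finite_abstract_simplicial_complex K \<longleftrightarrow>
     finite K \<and>
     (\<forall>x\<in>K. finite x \<and> x \<noteq> {}) \<and>
     (\<forall>x\<in>K. \<forall>y. y \<noteq> {} \<and> y \<subseteq> x \<longrightarrow> y \<in> K)"

definition complex_product :: "'a set set \<Rightarrow> 'b set set \<Rightarrow> ('a \<times> 'b) set set" where
  "complex_product G H = {x \<times> y | x y. x \<in> G \<and> y \<in> H}"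

text \<open>An undirected edge is represented by the two opposite arcs between its ends.\<close>

definition connection_graph :: "'c set set \<Rightarrow> 'c set pair_pre_digraph" where
  "connection_graph K =
     \<lparr> pverts = K, parcs = {(x, y). x \<in> K \<and> y \<in> K \<and> x \<noteq> y \<and> x \<inter> y \<noteq> {}} \<rparr>"

lemma pair_graph_connection_graph:
  assumes "finite K"
  shows "pair_graph (connection_graph K)"
proof -
  have "finite {(x, y). x \<in> K \<and> y \<in> K \<and> x \<noteq> y \<and> x \<inter> y \<noteq> {}}"
    by (rule finite_subset[of _ "K \<times> K"]) (use assms in auto)
  then show ?thesis
    using assms
    by unfold_locales
      (auto simp: connection_graph_def symmetric_def sym_def)
qed

text \<open>Rows and columns of the matrices below are indexed by the positions of a list that
  enumerates the vertices without repetition. The entries are complex, so that the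
  spectrum is the full spectrum without appeal to symmetry.\<close>

definition adjacency_matrix :: "'v pair_pre_digraph \<Rightarrow> 'v list \<Rightarrow> complex mat" where
  "adjacency_matrix \<Gamma> vs =
     mat (length vs) (length vs) (\<lambda>(i, j). if (vs ! i, vs ! j) \<in> parcs \<Gamma> then 1 else 0)"

definition connection_laplacian :: "'c set list \<Rightarrow> complex mat" where
  "connection_laplacian ks =
     1\<^sub>m (length ks) + adjacency_matrix (connection_graph (set ks)) ks"

text \<open>Eigenvalues with algebraic multiplicity, which for the real symmetric matrices above
  equals geometric multiplicity.\<close>

definition eigenvalue_mset :: "complex mat \<Rightarrow> complex multiset" where
  "eigenvalue_mset A = proots (char_poly A)"

text \<open>All pairwise products: the multiplicity of \<open>c\<close> is the sum, over all factorisations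
  \<open>c = a * b\<close>, of the multiplicity of \<open>a\<close> times that of \<open>b\<close>.\<close>

definition mset_product :: "complex multiset \<Rightarrow> complex multiset \<Rightarrow> complex multiset" where
  "mset_product M N = (\<Sum>a\<in>#M. {#a * b. b \<in># N#})"

end

theory Submission
  imports Defs
begin

text \<open>
  Two rectangles \<open>x \<times> y\<close> and \<open>x' \<times> y'\<close> meet if and only if \<open>x\<close> meets \<open>x'\<close> and \<open>y\<close> meets
  \<open>y'\<close>. Cells are non-empty, so the connection Laplacian is the 0/1 matrix of the relation
  ``the cells meet'', with the ones on the diagonal included. Hence, when the cells of
  \<open>G \<times> H\<close> are listed lexicographically, the Laplacian of the product is the Kronecker product
  of the two Laplacians (\<open>connection_laplacian_rectangles\<close>). Any other enumeration of the
  cells conjugates it by a permutation matrix (\<open>similar_mat_reindex\<close>) and leaves the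
  characteristic polynomial unchanged.

  The eigenvalues of a Kronecker product are the products of the eigenvalues, with algebraic
  multiplicity, for arbitrary complex square matrices (\<open>eigenvalue_mset_kronecker\<close>). By Schur
  triangularisation both factors are similar to upper triangular matrices; the mixed product
  rule makes the Kronecker product respect similarity; and the Kronecker product of two upper
  triangular matrices is upper triangular, its diagonal entries being the products of the
  diagonal entries of the factors. The statement on the spectra as sets is the statement on
  the multisets with the multiplicities forgotten.
\<close>

section \<open>Matrices indexed by lists\<close>

text \<open>
  Naming rows and columns by the entries of lists turns sums over positions into sums over
  sets. Both permutation matrices and Kronecker products have this form, and the product
  formula below is all that is needed to multiply them.
\<close>

definition indexed_mat :: "'i list \<Rightarrow> 'j list \<Rightarrow> ('i \<Rightarrow> 'j \<Rightarrow> 'r) \<Rightarrow> 'r mat" where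
  "indexed_mat xs ys f = mat (length xs) (length ys) (\<lambda>(i, j). f (xs ! i) (ys ! j))"

lemma dim_indexed_mat [simp]:
  "dim_row (indexed_mat xs ys f) = length xs"
  "dim_col (indexed_mat xs ys f) = length ys"
  by (simp_all add: indexed_mat_def)

lemma index_indexed_mat [simp]:
  "i < length xs \<Longrightarrow> j < length ys \<Longrightarrow> indexed_mat xs ys f $$ (i, j) = f (xs ! i) (ys ! j)"
  by (simp add: indexed_mat_def)

lemma indexed_mat_cong:
  assumes "\<And>x y. x \<in> set xs \<Longrightarrow> y \<in> set ys \<Longrightarrow> f x y = g x y"
  shows "indexed_mat xs ys f = indexed_mat xs ys g"
  by (rule eq_matI) (simp_all add: assms)

lemma indexed_mat_eq_one:
  assumes "distinct xs"
  shows "indexed_mat xs xs (\<lambda>x y. of_bool (x = y)) = 1\<^sub>m (length xs)"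
  by (rule eq_matI) (use assms in \<open>auto simp: nth_eq_iff_index_eq\<close>)

lemma indexed_mat_mult:
  fixes f :: "'i \<Rightarrow> 'j \<Rightarrow> 'r :: semiring_0"
  assumes "distinct ys"
  shows "indexed_mat xs ys f * indexed_mat ys zs g =
    indexed_mat xs zs (\<lambda>x z. \<Sum>y\<in>set ys. f x y * g y z)"
proof (rule eq_matI)
  fix i j
  assume "i < dim_row (indexed_mat xs zs (\<lambda>x z. \<Sum>y\<in>set ys. f x y * g y z))"
    and "j < dim_col (indexed_mat xs zs (\<lambda>x z. \<Sum>y\<in>set ys. f x y * g y z))"
  then have i: "i < length xs" and j: "j < length zs" by simp_all
  have "(indexed_mat xs ys f * indexed_mat ys zs g) $$ (i, j)
      = (\<Sum>k = 0..<length ys. f (xs ! i) (ys ! k) * g (ys ! k) (zs ! j))"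
    using i j by (simp add: scalar_prod_def)
  also have "\<dots> = (\<Sum>y\<in>set ys. f (xs ! i) y * g y (zs ! j))"
    using assms by (intro sum.reindex_bij_betw bij_betw_nth) auto
  finally show "(indexed_mat xs ys f * indexed_mat ys zs g) $$ (i, j)
      = indexed_mat xs zs (\<lambda>x z. \<Sum>y\<in>set ys. f x y * g y z) $$ (i, j)"
    using i j by simp
qed simp_all

lemma sum_of_bool_eq_mult:
  fixes f :: "'i \<Rightarrow> 'r :: semiring_1"
  assumes "finite A" and "x \<in> A"
  shows "(\<Sum>y\<in>A. of_bool (x = y) * f y) = f x"
proof -
  have "(\<Sum>y\<in>A. of_bool (x = y) * f y) = (\<Sum>y\<in>A. if x = y then f y else 0)"
    by (intro sum.cong) auto
  then show ?thesis using assms by (simp add: sum.delta')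
qed

lemma sum_mult_of_bool_eq:
  fixes f :: "'i \<Rightarrow> 'r :: semiring_1"
  assumes "finite A" and "z \<in> A"
  shows "(\<Sum>y\<in>A. f y * of_bool (y = z)) = f z"
proof -
  have "(\<Sum>y\<in>A. f y * of_bool (y = z)) = (\<Sum>y\<in>A. if y = z then f y else 0)"
    by (intro sum.cong) auto
  then show ?thesis using assms by (simp add: sum.delta)
qed

text \<open>
  The conjugating matrices are the permutation matrices with a one where the row and the
  column carry the same name.
\<close>

lemma similar_mat_reindex:
  fixes f :: "'i \<Rightarrow> 'i \<Rightarrow> 'r :: semiring_1"
  assumes xs: "distinct xs" and ys: "distinct ys" and same: "set xs = set ys"
  shows "similar_mat (indexed_mat xs xs f) (indexed_mat ys ys f)"
proof (rule similar_matI)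
  let ?P = "indexed_mat xs ys (\<lambda>x y. of_bool (x = y) :: 'r)"
  let ?Q = "indexed_mat ys xs (\<lambda>x y. of_bool (x = y) :: 'r)"
  have len: "length xs = length ys"
    using xs ys same by (metis distinct_card)
  show "{indexed_mat xs xs f, indexed_mat ys ys f, ?P, ?Q}
      \<subseteq> carrier_mat (length xs) (length xs)"
    using len by (simp add: carrier_matI)
  have "?P * ?Q = indexed_mat xs xs (\<lambda>x y. of_bool (x = y))"
    unfolding indexed_mat_mult[OF ys]
    by (rule indexed_mat_cong) (simp only: same sum_of_bool_eq_mult sum_mult_of_bool_eq finite_set)
  then show "?P * ?Q = 1\<^sub>m (length xs)"
    using indexed_mat_eq_one[OF xs] by simp
  have "?Q * ?P = indexed_mat ys ys (\<lambda>x y. of_bool (x = y))"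
    unfolding indexed_mat_mult[OF xs]
    by (rule indexed_mat_cong) (simp only: same sum_of_bool_eq_mult sum_mult_of_bool_eq finite_set)
  then show "?Q * ?P = 1\<^sub>m (length xs)"
    using indexed_mat_eq_one[OF ys] len by simp
  have "?P * indexed_mat ys ys f = indexed_mat xs ys f"
    unfolding indexed_mat_mult[OF ys]
    by (rule indexed_mat_cong) (simp only: same sum_of_bool_eq_mult sum_mult_of_bool_eq finite_set)
  moreover have "indexed_mat xs ys f * ?Q = indexed_mat xs xs f"
    unfolding indexed_mat_mult[OF ys]
    by (rule indexed_mat_cong) (simp only: same sum_of_bool_eq_mult sum_mult_of_bool_eq finite_set)
  ultimately show "indexed_mat xs xs f = ?P * indexed_mat ys ys f * ?Q"
    by simp
qed

section \<open>Kronecker products\<close>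

definition kronecker :: "'r :: times mat \<Rightarrow> 'r mat \<Rightarrow> 'r mat" where
  "kronecker A B =
     indexed_mat (List.product [0..<dim_row A] [0..<dim_row B])
       (List.product [0..<dim_col A] [0..<dim_col B])
       (\<lambda>(i, k) (j, l). A $$ (i, j) * B $$ (k, l))"

lemma dim_kronecker [simp]:
  "dim_row (kronecker A B) = dim_row A * dim_row B"
  "dim_col (kronecker A B) = dim_col A * dim_col B"
  by (simp_all add: kronecker_def)

lemma kronecker_carrier:
  "A \<in> carrier_mat m n \<Longrightarrow> B \<in> carrier_mat p q \<Longrightarrow> kronecker A B \<in> carrier_mat (m * p) (n * q)"
  by (intro carrier_matI) simp_all

lemma kronecker_index_bounds:
  fixes i m n :: nat
  assumes "i < m * n"
  shows "i div n < m" and "i mod n < n"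
proof -
  show "i div n < m" using assms by (simp add: less_mult_imp_div_less)
  have "n \<noteq> 0" using assms by (cases n) auto
  then show "i mod n < n" by simp
qed

lemma index_kronecker:
  assumes "i < dim_row A * dim_row B" and "j < dim_col A * dim_col B"
  shows "kronecker A B $$ (i, j) =
    A $$ (i div dim_row B, j div dim_col B) * B $$ (i mod dim_row B, j mod dim_col B)"
  using assms by (simp add: kronecker_def product_nth kronecker_index_bounds)

lemma kronecker_mult:
  fixes A :: "'r :: comm_semiring_0 mat"
  assumes A: "A \<in> carrier_mat m n" and C: "C \<in> carrier_mat n p"
    and B: "B \<in> carrier_mat m' n'" and D: "D \<in> carrier_mat n' p'"
  shows "kronecker A B * kronecker C D = kronecker (A * C) (B * D)"
proof -
  let ?mid = "List.product [0..<n] [0..<n']"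
  have "distinct ?mid" by (simp add: distinct_product)
  then have "kronecker A B * kronecker C D =
      indexed_mat (List.product [0..<m] [0..<m']) (List.product [0..<p] [0..<p'])
        (\<lambda>a c. \<Sum>b\<in>set ?mid. (\<lambda>(i, k) (j, l). A $$ (i, j) * B $$ (k, l)) a b *
                             (\<lambda>(i, k) (j, l). C $$ (i, j) * D $$ (k, l)) b c)"
    using A B C D by (simp add: kronecker_def indexed_mat_mult)
  also have "\<dots> = indexed_mat (List.product [0..<m] [0..<m']) (List.product [0..<p] [0..<p'])
        (\<lambda>(i, k) (j, l). (A * C) $$ (i, j) * (B * D) $$ (k, l))"
  proof (rule indexed_mat_cong, clarsimp)
    fix i k j l
    assume bounds: "i < m" "k < m'" "j < p" "l < p'"
    have "(A * C) $$ (i, j) * (B * D) $$ (k, l)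
        = (\<Sum>s = 0..<n. A $$ (i, s) * C $$ (s, j)) * (\<Sum>t = 0..<n'. B $$ (k, t) * D $$ (t, l))"
      using bounds A B C D by (simp add: scalar_prod_def)
    also have "\<dots> = (\<Sum>(s, t)\<in>{0..<n} \<times> {0..<n'}.
        (A $$ (i, s) * C $$ (s, j)) * (B $$ (k, t) * D $$ (t, l)))"
      by (simp add: sum_product sum.cartesian_product)
    finally show "(\<Sum>b\<in>{0..<n} \<times> {0..<n'}. (case b of (s, t) \<Rightarrow> A $$ (i, s) * B $$ (k, t)) *
          (case b of (s, t) \<Rightarrow> \<lambda>(j, l). C $$ (s, j) * D $$ (t, l)) (j, l))
        = (A * C) $$ (i, j) * (B * D) $$ (k, l)"
      by (simp add: case_prod_beta ac_simps)
  qed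
  also have "\<dots> = kronecker (A * C) (B * D)"
    using A B C D by (simp add: kronecker_def)
  finally show ?thesis .
qed

lemma kronecker_one:
  "kronecker (1\<^sub>m m) (1\<^sub>m n) = (1\<^sub>m (m * n) :: 'r :: semiring_1 mat)"
proof -
  let ?ix = "List.product [0..<m] [0..<n]"
  have "kronecker (1\<^sub>m m) (1\<^sub>m n) = indexed_mat ?ix ?ix (\<lambda>a b. of_bool (a = b) :: 'r)"
    unfolding kronecker_def index_one_mat(2,3)
    by (rule indexed_mat_cong) (auto split: if_splits)
  also have "\<dots> = 1\<^sub>m (m * n)"
    by (simp add: indexed_mat_eq_one distinct_product)
  finally show ?thesis .
qed

lemma similar_mat_kronecker:
  fixes A A' B B' :: "'r :: comm_semiring_1 mat"
  assumes "similar_mat A A'" and "similar_mat B B'"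
  shows "similar_mat (kronecker A B) (kronecker A' B')"
proof -
  obtain m P Q where A: "A \<in> carrier_mat m m" "A' \<in> carrier_mat m m"
      "P \<in> carrier_mat m m" "Q \<in> carrier_mat m m"
    and PQ: "P * Q = 1\<^sub>m m" "Q * P = 1\<^sub>m m" "A = P * A' * Q"
    using similar_matD[OF assms(1)] by auto
  obtain n R S where B: "B \<in> carrier_mat n n" "B' \<in> carrier_mat n n"
      "R \<in> carrier_mat n n" "S \<in> carrier_mat n n"
    and RS: "R * S = 1\<^sub>m n" "S * R = 1\<^sub>m n" "B = R * B' * S"
    using similar_matD[OF assms(2)] by auto
  show ?thesis
  proof (rule similar_matI)
    show "{kronecker A B, kronecker A' B', kronecker P R, kronecker Q S}
        \<subseteq> carrier_mat (m * n) (m * n)"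
      using A B by (auto intro: kronecker_carrier)
    show "kronecker P R * kronecker Q S = 1\<^sub>m (m * n)"
      using kronecker_mult[OF A(3,4) B(3,4)] PQ RS by (simp add: kronecker_one)
    show "kronecker Q S * kronecker P R = 1\<^sub>m (m * n)"
      using kronecker_mult[OF A(4,3) B(4,3)] PQ RS by (simp add: kronecker_one)
    show "kronecker A B = kronecker P R * kronecker A' B' * kronecker Q S"
      using A B by (simp add: kronecker_mult[of _ m m _ m _ n n _ n] PQ(3) RS(3))
  qed
qed

text \<open>
  Rows and columns are ordered lexicographically: a position below the diagonal lies below the
  diagonal of the first factor, or on it and below the diagonal of the second factor.
\<close>

lemma upper_triangular_kronecker:
  fixes A B :: "'r :: semiring_0 mat"
  assumes A: "A \<in> carrier_mat m m" "upper_triangular A"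
    and B: "B \<in> carrier_mat n n" "upper_triangular B"
  shows "upper_triangular (kronecker A B)"
proof (rule upper_triangularI)
  fix i j
  assume ji: "j < i" and "i < dim_row (kronecker A B)"
  then have i: "i < m * n" and j: "j < m * n"
    using A B by auto
  have eq: "kronecker A B $$ (i, j) = A $$ (i div n, j div n) * B $$ (i mod n, j mod n)"
    using i j A B by (simp add: index_kronecker)
  show "kronecker A B $$ (i, j) = 0"
  proof (cases "j div n < i div n")
    case True
    then have "A $$ (i div n, j div n) = 0"
      using A kronecker_index_bounds(1)[OF i] by auto
    then show ?thesis by (simp add: eq)
  next
    case False
    then have "j div n = i div n"
      using div_le_mono[of j i n] ji by simp
    then have "j mod n < i mod n"
      using ji by (metis div_mult_mod_eq nat_add_left_cancel_less)
    then have "B $$ (i mod n, j mod n) = 0"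
      using B kronecker_index_bounds(2)[OF i] by auto
    then show ?thesis by (simp add: eq)
  qed
qed

lemma diag_mat_kronecker:
  assumes "A \<in> carrier_mat m m" and "B \<in> carrier_mat n n"
  shows "diag_mat (kronecker A B) =
    map (\<lambda>(i, k). A $$ (i, i) * B $$ (k, k)) (List.product [0..<m] [0..<n])"
proof (rule nth_equalityI)
  show "length (diag_mat (kronecker A B)) =
      length (map (\<lambda>(i, k). A $$ (i, i) * B $$ (k, k)) (List.product [0..<m] [0..<n]))"
    using assms by (simp add: diag_mat_def)
next
  fix p
  assume "p < length (diag_mat (kronecker A B))"
  then have p: "p < m * n"
    using assms by (simp add: diag_mat_def)
  then show "diag_mat (kronecker A B) ! p =
      map (\<lambda>(i, k). A $$ (i, i) * B $$ (k, k)) (List.product [0..<m] [0..<n]) ! p"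
    using assms by (simp add: diag_mat_def index_kronecker product_nth kronecker_index_bounds)
qed

section \<open>Eigenvalues of Kronecker products\<close>

lemma mset_product_mset_map:
  "mset_product (mset (map f xs)) (mset (map g ys)) =
    mset (map (\<lambda>(x, y). f x * g y) (List.product xs ys))"
  by (induction xs) (simp_all add: mset_product_def multiset.map_comp comp_def)

lemma proots_prod_linear:
  fixes as :: "'r :: idom list"
  shows "proots (\<Prod>a\<leftarrow>as. [:- a, 1:]) = mset as"
proof (induction as)
  case (Cons a as)
  have "(\<Prod>a\<leftarrow>as. [:- a, 1:]) \<noteq> 0"
    by (auto simp: prod_list_zero_iff)
  then show ?case
    by (simp add: proots_mult Cons.IH del: mult_pCons_left)
qed simp

lemma eigenvalue_mset_upper_triangular:
  assumes "A \<in> carrier_mat n n" and "upper_triangular A"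
  shows "eigenvalue_mset A = mset (diag_mat A)"
  by (simp add: eigenvalue_mset_def char_poly_upper_triangular[OF assms] proots_prod_linear)

lemma eigenvalue_mset_similar:
  "similar_mat A B \<Longrightarrow> eigenvalue_mset A = eigenvalue_mset B"
  by (simp add: eigenvalue_mset_def char_poly_similar)

lemma similar_upper_triangular_exists:
  fixes A :: "complex mat"
  assumes "A \<in> carrier_mat n n"
  obtains T where "T \<in> carrier_mat n n" and "upper_triangular T" and "similar_mat A T"
  using char_poly_factorized[OF assms] schur_decomposition_exists[OF assms] by metis

theorem eigenvalue_mset_kronecker:
  assumes A: "A \<in> carrier_mat m m" and B: "B \<in> carrier_mat n n"
  shows "eigenvalue_mset (kronecker A B) = mset_product (eigenvalue_mset A) (eigenvalue_mset B)"
proof -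
  obtain S where S: "S \<in> carrier_mat m m" "upper_triangular S" "similar_mat A S"
    using similar_upper_triangular_exists[OF A] .
  obtain T where T: "T \<in> carrier_mat n n" "upper_triangular T" "similar_mat B T"
    using similar_upper_triangular_exists[OF B] .
  have "eigenvalue_mset (kronecker A B) = eigenvalue_mset (kronecker S T)"
    by (intro eigenvalue_mset_similar similar_mat_kronecker S T)
  also have "\<dots> = mset (diag_mat (kronecker S T))"
    using S T
    by (intro eigenvalue_mset_upper_triangular[of _ "m * n"] kronecker_carrier
        upper_triangular_kronecker)
  also have "\<dots> = mset_product (mset (diag_mat S)) (mset (diag_mat T))"
    unfolding diag_mat_kronecker[OF S(1) T(1)] unfolding diag_mat_def mset_product_mset_map
    using S T by simp
  also have "\<dots> = mset_product (eigenvalue_mset A) (eigenvalue_mset B)"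
    using S T by (simp add: eigenvalue_mset_similar eigenvalue_mset_upper_triangular)
  finally show ?thesis .
qed

lemma set_mset_mset_product:
  "set_mset (mset_product M N) = {a * b | a b. a \<in># M \<and> b \<in># N}"
  by (auto simp: mset_product_def)

lemma spectrum_eq_set_eigenvalue_mset:
  assumes "A \<in> carrier_mat n n"
  shows "spectrum A = set_mset (eigenvalue_mset A)"
proof -
  have "char_poly A \<noteq> 0"
    using degree_monic_char_poly[OF assms] by (metis coeff_0 zero_neq_one)
  then show ?thesis
    by (auto simp: spectrum_def eigenvalue_mset_def eigenvalue_root_char_poly[OF assms])
qed

section \<open>Connection Laplacians\<close>

lemma connection_laplacian_carrier:
  "connection_laplacian ks \<in> carrier_mat (length ks) (length ks)"
  by (simp add: connection_laplacian_def adjacency_matrix_def)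

text \<open>
  A non-empty cell meets itself, so the identity matrix in the Laplacian supplies precisely the
  diagonal entries that the adjacency matrix lacks.
\<close>

lemma connection_laplacian_eq_meet_matrix:
  assumes "distinct ks" and "{} \<notin> set ks"
  shows "connection_laplacian ks = indexed_mat ks ks (\<lambda>x y. of_bool (x \<inter> y \<noteq> {}))"
proof (rule eq_matI)
  fix i j
  assume "i < dim_row (indexed_mat ks ks (\<lambda>x y. of_bool (x \<inter> y \<noteq> {}) :: complex))"
    and "j < dim_col (indexed_mat ks ks (\<lambda>x y. of_bool (x \<inter> y \<noteq> {}) :: complex))"
  then have ij: "i < length ks" "j < length ks" by simp_all
  then have "ks ! i \<noteq> {}" using assms(2) by (metis nth_mem)
  then show "connection_laplacian ks $$ (i, j) =
      indexed_mat ks ks (\<lambda>x y. of_bool (x \<inter> y \<noteq> {})) $$ (i, j)"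
    using ij assms(1)
    by (auto simp: connection_laplacian_def adjacency_matrix_def connection_graph_def
        nth_eq_iff_index_eq)
qed (simp_all add: connection_laplacian_def adjacency_matrix_def)

lemma similar_connection_laplacian_reorder:
  assumes "distinct ks" and "distinct ls" and "set ks = set ls" and "{} \<notin> set ks"
  shows "similar_mat (connection_laplacian ks) (connection_laplacian ls)"
  using assms by (simp add: connection_laplacian_eq_meet_matrix similar_mat_reindex)

definition rectangles :: "'a set list \<Rightarrow> 'b set list \<Rightarrow> ('a \<times> 'b) set list" where
  "rectangles gs hs = map (\<lambda>(x, y). x \<times> y) (List.product gs hs)"

lemma set_rectangles: "set (rectangles gs hs) = complex_product (set gs) (set hs)"
  by (auto simp: rectangles_def complex_product_def)

text \<open>A non-empty rectangle determines its two sides, so no cell is listed twice.\<close>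

lemma distinct_rectangles:
  assumes "distinct gs" and "distinct hs" and "{} \<notin> set gs" and "{} \<notin> set hs"
  shows "distinct (rectangles gs hs)"
proof -
  have "inj_on (\<lambda>(x, y). x \<times> y) (set gs \<times> set hs)"
    using assms(3,4) by (auto simp: inj_on_def times_eq_iff)
  then show ?thesis
    using assms(1,2) by (simp add: rectangles_def distinct_map distinct_product)
qed

lemma empty_notin_rectangles:
  assumes "{} \<notin> set gs" and "{} \<notin> set hs"
  shows "{} \<notin> set (rectangles gs hs)"
  using assms by (auto simp: rectangles_def dest: sym)

text \<open>
  \<open>(x \<times> y) \<inter> (x' \<times> y') = (x \<inter> x') \<times> (y \<inter> y')\<close> is non-empty
  if and only if both factors are, so the entries multiply; the lexicographic order of
  \<open>rectangles\<close> is the one of the Kronecker product.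
\<close>

lemma connection_laplacian_rectangles:
  assumes gs: "distinct gs" "{} \<notin> set gs" and hs: "distinct hs" "{} \<notin> set hs"
  shows "connection_laplacian (rectangles gs hs) =
    kronecker (connection_laplacian gs) (connection_laplacian hs)"
proof -
  let ?M = "\<lambda>ks. indexed_mat ks ks (\<lambda>x y. of_bool (x \<inter> y \<noteq> {}) :: complex)"
  have "?M (rectangles gs hs) = kronecker (?M gs) (?M hs)"
    by (rule eq_matI)
      (auto simp: rectangles_def index_kronecker product_nth kronecker_index_bounds Times_Int_Times)
  moreover have "connection_laplacian (rectangles gs hs) = ?M (rectangles gs hs)"
    using gs hs by (intro connection_laplacian_eq_meet_matrix distinct_rectangles
        empty_notin_rectangles)
  ultimately show ?thesis
    using gs hs by (simp add: connection_laplacian_eq_meet_matrix)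
qed

theorem corollary1:
  fixes G :: "'a set set" and H :: "'b set set"
    and gs :: "'a set list" and hs :: "'b set list" and ks :: "('a \<times> 'b) set list"
  assumes "finite_abstract_simplicial_complex G"
    and "finite_abstract_simplicial_complex H"
    and "distinct gs" and "set gs = G"
    and "distinct hs" and "set hs = H"
    and "distinct ks" and "set ks = complex_product G H"
  shows "spectrum (connection_laplacian ks) =
           {a * b | a b. a \<in> spectrum (connection_laplacian gs) \<and>
                         b \<in> spectrum (connection_laplacian hs)}
       \<and> eigenvalue_mset (connection_laplacian ks) =
           mset_product (eigenvalue_mset (connection_laplacian gs))
                        (eigenvalue_mset (connection_laplacian hs))"
proof -
  have gs: "{} \<notin> set gs" and hs: "{} \<notin> set hs"
    using assms by (auto simp: finite_abstract_simplicial_complex_def)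
  let ?rs = "rectangles gs hs"
  have ks: "set ks = set ?rs"
    using assms by (simp add: set_rectangles)
  have "{} \<notin> set ks"
    unfolding ks by (rule empty_notin_rectangles[OF gs hs])
  then have "similar_mat (connection_laplacian ks) (connection_laplacian ?rs)"
    using assms(3,5,7) gs hs ks
    by (intro similar_connection_laplacian_reorder distinct_rectangles)
  then have "eigenvalue_mset (connection_laplacian ks) =
      eigenvalue_mset (kronecker (connection_laplacian gs) (connection_laplacian hs))"
    using assms(3,5) gs hs by (simp add: eigenvalue_mset_similar connection_laplacian_rectangles)
  also have "\<dots> = mset_product (eigenvalue_mset (connection_laplacian gs))
                     (eigenvalue_mset (connection_laplacian hs))"
    by (rule eigenvalue_mset_kronecker[OF connection_laplacian_carrier connection_laplacian_carrier])
  finally have multiset: "eigenvalue_mset (connection_laplacian ks) =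
      mset_product (eigenvalue_mset (connection_laplacian gs))
        (eigenvalue_mset (connection_laplacian hs))" .
  have "spectrum (connection_laplacian ks) = {a * b | a b.
      a \<in> spectrum (connection_laplacian gs) \<and> b \<in> spectrum (connection_laplacian hs)}"
    by (simp add: spectrum_eq_set_eigenvalue_mset[OF connection_laplacian_carrier] multiset
        set_mset_mset_product)
  then show ?thesis
    using multiset by blast
qed

end
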